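(* Suppose $f$ satisfies the $(r,2r)$-restricted strict convexity property. Let $\widehat{\mathbf{Y}}\in\mathbb{R}^{p\times r}$ be such that $\widehat{\mathbf{Y}}\widehat{\mathbf{Y}}^\top$ has rank $r$ and is a local minimizer of $$\min\{f(\mathbf{X}):\ \mathbf{X}\in\mathbb{R}^{p\times p}\text{ symmetric},\ \mathbf{X}\succcurlyeq0,\ \mathrm{rank}(\mathbf{X})\le2r\}.$$ Then there exists a neighborhood of $[\widehat{\mathbf{Y}}]$ in $\mathcal{M}$ on which $h$ is geodesically convex.
   Context: Let $0<r\le p$ be integers. $f:\mathbb{R}^{p\times p}\to\mathbb{R}$ is twice continuously differentiable with $f(\mathbf{X})=f(\mathbf{X}^\top)$; $\nabla^2f(\mathbf{X})[\cdot,\cdot]$ is its Euclidean Hessian bilinear form. $f$ satisfies the $(r,2r)$-restricted strict convexity property if $\nabla^2f(\mathbf{X})[\mathbf{G},\mathbf{G}]>0$ for all $\mathbf{X},\mathbf{G}\in\mathbb{R}^{p\times p}$ with $\mathrm{rank}(\mathbf{X})\le r$, $\mathrm{rank}(\mathbf{G})\le2r$, $\mathbf{G}\ne0$. $\mathbb{R}^{p\times r}_*$ is the set of real $p\times r$ matrices of full column rank, $\mathbb{O}_r$ the orthogonal group, and $\mathcal{M}=\mathbb{R}^{p\times r}_*/\mathbb{O}_r$ the quotient manifold with points $[\mathbf{Y}]=\{\mathbf{Y}\mathbf{O}:\mathbf{O}\in\mathbb{O}_r\}$ and the Riemannian metric induced from the Euclidean metric $\mathrm{tr}(\eta^\top\theta)$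 on $\mathbb{R}^{p\times r}_*$; tangent vectors at $[\mathbf{Y}]$ are represented by horizontal lifts in $\mathcal{H}_{\mathbf{Y}}=\{\theta\in\mathbb{R}^{p\times r}:\mathbf{Y}^\top\theta\text{ symmetric}\}$ (the orthogonal complement of the vertical space). $h:\mathcal{M}\to\mathbb{R}$ is $h([\mathbf{Y}])=f(\mathbf{Y}\mathbf{Y}^\top)$. A function is geodesically convex on a subset of $\mathcal{M}$ if the subset is geodesically convex (any two of its points can be joined by a geodesic contained in it) and the Riemannian Hessian of the function is positive semidefinite at every point of the subset. *)

theory Defs
  imports "HOL-Analysis.Analysis"
begin

definition twice_continuously_differentiable :: "('a::real_normed_vector \<Rightarrow> real) \<Rightarrow> bool" where
  "twice_continuously_differentiable f \<longleftrightarrow>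
     (\<exists>(f' :: 'a \<Rightarrow> 'a \<Rightarrow>\<^sub>L real) (f'' :: 'a \<Rightarrow> 'a \<Rightarrow>\<^sub>L 'a \<Rightarrow>\<^sub>L real).
        (\<forall>x. (f has_derivative blinfun_apply (f' x)) (at x)) \<and>
        (\<forall>x. (f' has_derivative blinfun_apply (f'' x)) (at x)) \<and>
        continuous_on UNIV f'')"

definition euclidean_hessian ::
  "('a::real_normed_vector \<Rightarrow> real) \<Rightarrow> 'a \<Rightarrow> 'a \<Rightarrow> 'a \<Rightarrow> real" where
  "euclidean_hessian f X G H =
     frechet_derivative (\<lambda>Z. frechet_derivative f (at Z) H) (at X) G"

definition restricted_strictly_convex ::
  "nat \<Rightarrow> nat \<Rightarrow> (real^'p^'p \<Rightarrow> real) \<Rightarrow> bool" where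
  "restricted_strictly_convex r s f \<longleftrightarrow>
     (\<forall>X G. rank X \<le> r \<longrightarrow> rank G \<le> s \<longrightarrow> G \<noteq> 0 \<longrightarrow> euclidean_hessian f X G G > 0)"

definition positive_semidefinite :: "real^'p^'p \<Rightarrow> bool" where
  "positive_semidefinite X \<longleftrightarrow> transpose X = X \<and> (\<forall>v. 0 \<le> v \<bullet> (X *v v))"

definition local_minimizer_on :: "('a::metric_space \<Rightarrow> real) \<Rightarrow> 'a set \<Rightarrow> 'a \<Rightarrow> bool" where
  "local_minimizer_on f S x \<longleftrightarrow>
     x \<in> S \<and> (\<exists>\<epsilon>>0. \<forall>y\<in>S. dist y x < \<epsilon> \<longrightarrow> f x \<le> f y)"

text \<open>A \<open>p \<times> r\<close> matrix has type \<open>real^'r^'p\<close>; the library inner product on this type is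
  the metric \<open>tr (\<eta>\<^sup>T \<theta>)\<close>.\<close>

definition full_column_rank :: "(real^'r^'p) set" where
  "full_column_rank = {Y. rank Y = CARD('r)}"

definition orbit :: "real^'r^'p \<Rightarrow> (real^'r^'p) set" where
  "orbit Y = {Y ** Q | Q. orthogonal_matrix Q}"

definition quotient_topology :: "(real^'r^'p) set topology" where
  "quotient_topology = topology (\<lambda>U. U \<subseteq> orbit ` full_column_rank \<and>
     openin (top_of_set full_column_rank) {Y \<in> full_column_rank. orbit Y \<in> U})"

lemma openin_quotient_topology:
  fixes U :: "(real^'r^'p) set set"
  shows "openin quotient_topology U \<longleftrightarrow> U \<subseteq> orbit ` full_column_rank \<and>
     openin (top_of_set full_column_rank) {Y \<in> full_column_rank. orbit Y \<in> U}"
proof -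
  let ?P = "\<lambda>U :: (real^'r^'p) set set. U \<subseteq> orbit ` full_column_rank \<and>
     openin (top_of_set full_column_rank) {Y \<in> full_column_rank. orbit Y \<in> U}"
  have "istopology ?P"
    unfolding istopology_def
  proof (intro conjI allI impI)
    fix S T :: "(real^'r^'p) set set" assume S: "?P S" and T: "?P T"
    from S show "S \<inter> T \<subseteq> orbit ` full_column_rank" by (meson Int_lower1 order_trans)
    have "{Y \<in> full_column_rank. orbit Y \<in> S \<inter> T} =
        {Y \<in> full_column_rank. orbit Y \<in> S} \<inter> {Y \<in> full_column_rank. orbit Y \<in> T}"
      by auto
    then show "openin (top_of_set full_column_rank) {Y \<in> full_column_rank. orbit Y \<in> S \<inter> T}"
      using openin_Int[OF conjunct2[OF S] conjunct2[OF T]] by (rule ssubst)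
  next
    fix K :: "(real^'r^'p) set set set" assume K: "\<forall>U\<in>K. ?P U"
    then show "\<Union> K \<subseteq> orbit ` full_column_rank" by (meson Sup_least)
    have "{Y \<in> full_column_rank. orbit Y \<in> \<Union> K} =
        \<Union> ((\<lambda>U. {Y \<in> full_column_rank. orbit Y \<in> U}) ` K)"
      by auto
    moreover have "openin (top_of_set full_column_rank) \<dots>"
      by (rule openin_Union) (use K in blast)
    ultimately show "openin (top_of_set full_column_rank) {Y \<in> full_column_rank. orbit Y \<in> \<Union> K}"
      by simp
  qed
  then show ?thesis
    unfolding quotient_topology_def by (simp add: topology_inverse')
qed

text \<open>The function induced on orbits by \<open>Y \<mapsto> f (Y Y\<^sup>T)\<close>; the image below is a singleton.\<close>

definition quotient_fun ::
  "(real^'p^'p \<Rightarrow> real) \<Rightarrow> (real^'r^'p) set \<Rightarrow> real" where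
  "quotient_fun f S = the_elem ((\<lambda>Y. f (Y ** transpose Y)) ` S)"

lemma quotient_fun_orbit: "quotient_fun f (orbit Y) = f (Y ** transpose Y)"
proof -
  have nonempty: "orbit Y \<noteq> {}"
    unfolding orbit_def using orthogonal_matrix_id by blast
  have const: "f (Z ** transpose Z) = f (Y ** transpose Y)" if Z_in: "Z \<in> orbit Y" for Z
  proof -
    obtain Q where Z: "Z = Y ** Q" and Q: "Q ** transpose Q = mat 1"
      using Z_in by (auto simp: orbit_def orthogonal_matrix_def)
    have "Z ** transpose Z = Y ** (Q ** transpose Q) ** transpose Y"
      by (simp add: Z matrix_transpose_mul matrix_mul_assoc)
    then show ?thesis by (simp add: Q)
  qed
  have "(\<lambda>Z. f (Z ** transpose Z)) ` orbit Y = (\<lambda>_. f (Y ** transpose Y)) ` orbit Y"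
    by (rule image_cong[OF refl const])
  also have "\<dots> = {f (Y ** transpose Y)}"
    by (rule image_constant_conv[THEN trans]) (simp add: nonempty)
  finally show ?thesis by (simp add: quotient_fun_def)
qed

definition horizontal :: "real^'r^'p \<Rightarrow> (real^'r^'p) set" where
  "horizontal Y = {\<theta>. transpose (transpose Y ** \<theta>) = transpose Y ** \<theta>}"

definition horizontal_proj :: "real^'r^'p \<Rightarrow> real^'r^'p \<Rightarrow> real^'r^'p" where
  "horizontal_proj Y = closest_point (horizontal Y)"

lemma subspace_horizontal: "subspace (horizontal Y)"
proof -
  let ?A = "\<lambda>\<theta>. transpose (transpose Y ** \<theta>) - transpose Y ** \<theta>"
  have "linear ?A"
    by (rule linearI)
      (simp_all add: vec_eq_iff transpose_def matrix_matrix_mult_def distrib_left sum.distrib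
        sum_distrib_left right_diff_distrib mult.left_commute)
  then have "subspace {\<theta>. ?A \<theta> = 0}"
    by (rule linear_subspace_kernel)
  then show ?thesis by (simp add: horizontal_def)
qed

text \<open>Below, tangent vectors and vector fields of the quotient are given by their horizontal lifts.
  The covariant derivative of a field \<open>V\<close> in the direction \<open>\<theta>\<close> (respectively of a field along a
  curve) has as its lift the horizontal part of the Euclidean derivative of the lift. That this is
  the Levi-Civita connection of the induced metric is the content of the lemmas
  \<open>covariant_derivative_metric\<close> and \<open>covariant_derivative_torsion_free\<close>; the horizontal part of
  the Euclidean Lie bracket is the lift of the Lie bracket of the projected fields.\<close>

definition covariant_derivative ::
  "real^'r^'p \<Rightarrow> real^'r^'p \<Rightarrow> (real^'r^'p \<Rightarrow> real^'r^'p) \<Rightarrow> real^'r^'p" where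
  "covariant_derivative Y \<theta> V = horizontal_proj Y (frechet_derivative V (at Y) \<theta>)"

lemma horizontal_proj_in: "horizontal_proj Y Z \<in> horizontal Y"
  unfolding horizontal_proj_def
  using subspace_0[OF subspace_horizontal] closed_subspace[OF subspace_horizontal]
  by (metis closest_point_in_set empty_iff)

lemma horizontal_proj_inner:
  assumes "\<theta> \<in> horizontal Y"
  shows "horizontal_proj Y Z \<bullet> \<theta> = Z \<bullet> \<theta>"
proof -
  let ?P = "horizontal_proj Y Z"
  have le: "(Z - ?P) \<bullet> v \<le> 0" if "v \<in> horizontal Y" for v
  proof -
    have "?P + v \<in> horizontal Y"
      using subspace_add[OF subspace_horizontal horizontal_proj_in that] .
    then have "(Z - ?P) \<bullet> (?P + v - ?P) \<le> 0"
      unfolding horizontal_proj_def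
      by (rule closest_point_dot[OF subspace_imp_convex[OF subspace_horizontal]
            closed_subspace[OF subspace_horizontal]])
    then show ?thesis by simp
  qed
  have "- \<theta> \<in> horizontal Y"
    using subspace_neg[OF subspace_horizontal assms] .
  from le[OF assms] le[OF this] show ?thesis by (simp add: inner_diff_left)
qed

lemma horizontal_proj_unique:
  assumes "P \<in> horizontal Y" and "\<And>\<theta>. \<theta> \<in> horizontal Y \<Longrightarrow> P \<bullet> \<theta> = Z \<bullet> \<theta>"
  shows "horizontal_proj Y Z = P"
proof -
  have D: "horizontal_proj Y Z - P \<in> horizontal Y"
    using subspace_diff[OF subspace_horizontal horizontal_proj_in assms(1)] .
  have "(horizontal_proj Y Z - P) \<bullet> (horizontal_proj Y Z - P) = 0"
    using assms(2)[OF D] horizontal_proj_inner[OF D, of Z] by (simp add: inner_diff_left)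
  then show ?thesis by simp
qed

lemma covariant_derivative_metric:
  assumes "V differentiable (at Y)" "W differentiable (at Y)"
    and "V Y \<in> horizontal Y" "W Y \<in> horizontal Y"
  shows "frechet_derivative (\<lambda>Z. V Z \<bullet> W Z) (at Y) \<theta> =
           covariant_derivative Y \<theta> V \<bullet> W Y + V Y \<bullet> covariant_derivative Y \<theta> W"
proof -
  have "((\<lambda>Z. V Z \<bullet> W Z) has_derivative
     (\<lambda>\<theta>. V Y \<bullet> frechet_derivative W (at Y) \<theta> + frechet_derivative V (at Y) \<theta> \<bullet> W Y)) (at Y)"
    using assms(1,2) by (intro has_derivative_inner) (simp_all add: frechet_derivative_works)
  from frechet_derivative_at[OF this, symmetric] show ?thesis
    using horizontal_proj_inner[OF assms(4)] horizontal_proj_inner[OF assms(3)]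
    by (simp add: covariant_derivative_def inner_commute)
qed

lemma covariant_derivative_torsion_free:
  "covariant_derivative Y (V Y) W - covariant_derivative Y (W Y) V =
     horizontal_proj Y (frechet_derivative W (at Y) (V Y) - frechet_derivative V (at Y) (W Y))"
  unfolding covariant_derivative_def
  by (rule horizontal_proj_unique[symmetric])
    (simp_all add: inner_diff_left horizontal_proj_inner
      subspace_diff[OF subspace_horizontal horizontal_proj_in horizontal_proj_in])

definition riemannian_gradient ::
  "((real^'r^'p) set \<Rightarrow> real) \<Rightarrow> real^'r^'p \<Rightarrow> real^'r^'p" where
  "riemannian_gradient h Y = (THE g. g \<in> horizontal Y \<and>
     (\<forall>\<theta>\<in>horizontal Y. frechet_derivative (\<lambda>Z. h (orbit Z)) (at Y) \<theta> = g \<bullet> \<theta>))"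

definition riemannian_hessian ::
  "((real^'r^'p) set \<Rightarrow> real) \<Rightarrow> real^'r^'p \<Rightarrow> real^'r^'p \<Rightarrow> real^'r^'p \<Rightarrow> real" where
  "riemannian_hessian h Y \<theta> \<eta> = covariant_derivative Y \<theta> (riemannian_gradient h) \<bullet> \<eta>"

text \<open>A geodesic segment is a curve of zero acceleration; \<open>\<gamma>\<close> is a horizontal lift of \<open>c\<close>, with
  velocity \<open>\<gamma>'\<close>, and \<open>horizontal_proj (\<gamma> t) (\<gamma>'' t)\<close> lifts the covariant derivative of the
  velocity of \<open>c\<close> along \<open>c\<close>.\<close>

definition geodesic_segment :: "(real \<Rightarrow> (real^'r^'p) set) \<Rightarrow> bool" where
  "geodesic_segment c \<longleftrightarrow> (\<exists>\<gamma> \<gamma>' \<gamma>''. \<forall>t\<in>{0..1}.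
     \<gamma> t \<in> full_column_rank \<and> c t = orbit (\<gamma> t) \<and>
     (\<gamma> has_vector_derivative \<gamma>' t) (at t within {0..1}) \<and>
     \<gamma>' t \<in> horizontal (\<gamma> t) \<and>
     (\<gamma>' has_vector_derivative \<gamma>'' t) (at t within {0..1}) \<and>
     horizontal_proj (\<gamma> t) (\<gamma>'' t) = 0)"

definition geodesically_convex :: "(real^'r^'p) set set \<Rightarrow> bool" where
  "geodesically_convex U \<longleftrightarrow> U \<subseteq> orbit ` full_column_rank \<and>
     (\<forall>A\<in>U. \<forall>B\<in>U. \<exists>c. geodesic_segment c \<and> c 0 = A \<and> c 1 = B \<and> c ` {0..1} \<subseteq> U)"

definition geodesically_convex_on ::
  "(real^'r^'p) set set \<Rightarrow> ((real^'r^'p) set \<Rightarrow> real) \<Rightarrow> bool" where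
  "geodesically_convex_on U h \<longleftrightarrow> geodesically_convex U \<and>
     (\<forall>Y\<in>full_column_rank. orbit Y \<in> U \<longrightarrow>
        (\<forall>\<theta>\<in>horizontal Y. 0 \<le> riemannian_hessian h Y \<theta> \<theta>))"

end

theory Submission
  imports Defs
begin

text \<open>The horizontal lifts of geodesics are straight lines, and the Riemannian Hessian of \<open>h\<close> on a
  horizontal \<open>\<theta>\<close> is \<open>f''(Y Y\<^sup>T)[S, S] + 2 f'(Y Y\<^sup>T)[\<theta> \<theta>\<^sup>T]\<close> with \<open>S = Y \<theta>\<^sup>T + \<theta> Y\<^sup>T\<close>. Since \<open>r < 2 r\<close>,
  a rank-one perturbation of the minimizer \<open>X\<close> in any direction \<open>u u\<^sup>T\<close> is admissible, so the second
  term is nonnegative whenever \<open>Y Y\<^sup>T = X\<close>; the first is then positive because \<open>S\<close> has rank at most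
  \<open>2 r\<close> and vanishes only for \<open>\<theta> = 0\<close>. By compactness the Hessian stays positive for
  \<open>\<parallel>Y Y\<^sup>T - X\<parallel> < \<epsilon>\<close>. For small \<open>\<epsilon>\<close> this set of orbits is geodesically convex: two points are
  joined by the segment between representatives \<open>Y\<close>, \<open>Z\<close> with \<open>Y\<^sup>T Z\<close> symmetric and positive
  semidefinite, along which \<open>\<parallel>Y Y\<^sup>T - X\<parallel>\<close> cannot exceed its maximum over the end points.\<close>

section \<open>Matrix products, transposes and the Frobenius inner product\<close>

lemma bounded_bilinear_matrix_mult:
  "bounded_bilinear ((**) :: real^'n^'m \<Rightarrow> real^'k^'n \<Rightarrow> real^'k^'m)"
  by (subst bilinear_conv_bounded_bilinear[symmetric])
    (auto simp: bilinear_def intro!: linearI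
      simp: vec_eq_iff matrix_matrix_mult_def distrib_left distrib_right sum.distrib sum_distrib_left
        mult.left_commute mult.assoc)

lemma bounded_linear_transpose: "bounded_linear (transpose :: real^'n^'m \<Rightarrow> real^'m^'n)"
  by (auto simp: transpose_def vec_eq_iff intro!: linearI linear_conv_bounded_linear[THEN iffD1])

lemmas matrix_mult_linear_simps =
  bounded_bilinear.add_left[OF bounded_bilinear_matrix_mult]
  bounded_bilinear.add_right[OF bounded_bilinear_matrix_mult]
  bounded_bilinear.diff_left[OF bounded_bilinear_matrix_mult]
  bounded_bilinear.diff_right[OF bounded_bilinear_matrix_mult]
  bounded_bilinear.scaleR_left[OF bounded_bilinear_matrix_mult]
  bounded_bilinear.scaleR_right[OF bounded_bilinear_matrix_mult]
  bounded_bilinear.minus_left[OF bounded_bilinear_matrix_mult]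
  bounded_bilinear.minus_right[OF bounded_bilinear_matrix_mult]
  linear_add[OF bounded_linear.linear[OF bounded_linear_transpose]]
  linear_diff[OF bounded_linear.linear[OF bounded_linear_transpose]]
  linear_scale[OF bounded_linear.linear[OF bounded_linear_transpose]]
  linear_neg[OF bounded_linear.linear[OF bounded_linear_transpose]]
  bounded_bilinear.zero_left[OF bounded_bilinear_matrix_mult]
  bounded_bilinear.zero_right[OF bounded_bilinear_matrix_mult]
  linear_0[OF bounded_linear.linear[OF bounded_linear_transpose]]

lemma continuous_on_matrix_mult [continuous_intros]:
  fixes F :: "'a::topological_space \<Rightarrow> real^'n^'m" and G :: "'a \<Rightarrow> real^'k^'n"
  assumes "continuous_on S F" "continuous_on S G"
  shows "continuous_on S (\<lambda>x. F x ** G x)"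
  by (rule bounded_bilinear.continuous_on[OF bounded_bilinear_matrix_mult assms])

lemma continuous_on_transpose [continuous_intros]:
  fixes F :: "'a::topological_space \<Rightarrow> real^'n^'m"
  assumes "continuous_on S F"
  shows "continuous_on S (\<lambda>x. transpose (F x))"
  by (rule bounded_linear.continuous_on[OF bounded_linear_transpose assms])

lemma has_derivative_matrix_mult [derivative_intros]:
  fixes F :: "'a::real_normed_vector \<Rightarrow> real^'n^'m" and G :: "'a \<Rightarrow> real^'k^'n"
  assumes "(F has_derivative F') (at x within S)" "(G has_derivative G') (at x within S)"
  shows "((\<lambda>x. F x ** G x) has_derivative (\<lambda>h. F x ** G' h + F' h ** G x)) (at x within S)"
  by (rule bounded_bilinear.FDERIV[OF bounded_bilinear_matrix_mult assms])

lemma has_derivative_transpose [derivative_intros]: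
  fixes F :: "'a::real_normed_vector \<Rightarrow> real^'n^'m"
  assumes "(F has_derivative F') (at x within S)"
  shows "((\<lambda>x. transpose (F x)) has_derivative (\<lambda>h. transpose (F' h))) (at x within S)"
  by (rule bounded_linear.has_derivative[OF bounded_linear_transpose assms])

lemma inner_matrix: "A \<bullet> B = (\<Sum>i\<in>UNIV. \<Sum>j\<in>UNIV. A$i$j * (B :: real^'n^'m)$i$j)"
  by (simp add: inner_vec_def)

lemma inner_transpose: "transpose A \<bullet> transpose B = A \<bullet> (B :: real^'n^'m)"
  unfolding inner_matrix by (subst sum.swap) (simp add: transpose_def)

lemma inner_transpose_left: "transpose A \<bullet> B = A \<bullet> transpose (B :: real^'n^'m)"
  using inner_transpose[of A "transpose B"] by simp

lemma inner_matrix_mult_right: "(A ** B) \<bullet> C = A \<bullet> (C ** transpose (B :: real^'k^'n))"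
  for A :: "real^'n^'m" and C :: "real^'k^'m"
proof -
  have "(\<Sum>j\<in>UNIV. (\<Sum>k\<in>UNIV. A$i$k * B$k$j) * C$i$j) =
      (\<Sum>k\<in>UNIV. A$i$k * (\<Sum>j\<in>UNIV. C$i$j * B$k$j))" for i
    unfolding sum_distrib_left sum_distrib_right
    by (subst sum.swap) (simp add: mult_ac)
  then show ?thesis
    by (simp add: inner_matrix matrix_matrix_mult_def transpose_def)
qed

lemma inner_matrix_mult_left: "(A ** B) \<bullet> C = B \<bullet> (transpose A ** (C :: real^'k^'m))"
  for A :: "real^'n^'m" and B :: "real^'k^'n"
proof -
  have "(A ** B) \<bullet> C = (transpose B ** transpose A) \<bullet> transpose C"
    by (simp add: inner_transpose flip: matrix_transpose_mul)
  also have "\<dots> = transpose B \<bullet> transpose (transpose A ** C)"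
    by (simp add: inner_matrix_mult_right matrix_transpose_mul)
  finally show ?thesis by (simp add: inner_transpose)
qed

text \<open>The entries of \<open>D D^T\<close> are inner products of rows of \<open>D\<close>, so
  Cauchy-Schwarz bounds each square by a product, and the double sum factors. This controls the
  error term \<open>D D^T\<close> along a segment.\<close>

lemma norm_matrix_mult_transpose_le: "norm (D ** transpose D) \<le> (norm (D :: real^'n^'m))\<^sup>2"
proof -
  have "(D ** transpose D)$i$j = D$i \<bullet> D$j" for i j
    by (simp add: matrix_matrix_mult_def transpose_def inner_vec_def)
  then have "(norm (D ** transpose D))\<^sup>2 = (\<Sum>i\<in>UNIV. \<Sum>j\<in>UNIV. (D$i \<bullet> D$j)\<^sup>2)"
    by (simp add: power2_norm_eq_inner inner_matrix flip: power2_eq_square)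
  also have "\<dots> \<le> (\<Sum>i\<in>UNIV. \<Sum>j\<in>UNIV. (D$i \<bullet> D$i) * (D$j \<bullet> D$j))"
    by (intro sum_mono Cauchy_Schwarz_ineq)
  also have "\<dots> = (D \<bullet> D)\<^sup>2"
    unfolding power2_eq_square inner_vec_def[of D D] sum_product ..
  also have "\<dots> = ((norm D)\<^sup>2)\<^sup>2"
    by (metis power2_norm_eq_inner)
  finally show ?thesis by (rule power2_le_imp_le) simp
qed

text \<open>The squared norm of \<open>Y\<close> is the trace of \<open>Y Y^T\<close>, that is, its
  pairing with the identity. Hence a bound on \<open>Y Y^T\<close> confines \<open>Y\<close> to a
  ball, as the compactness argument requires.\<close>

lemma norm_le_norm_matrix_mult_transpose:
  "(norm Y)\<^sup>2 \<le> norm (mat 1 :: real^'m^'m) * norm (Y ** transpose (Y :: real^'n^'m))"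
proof -
  have "(norm Y)\<^sup>2 = mat 1 \<bullet> (Y ** transpose Y)"
    using inner_matrix_mult_right[of "mat 1" Y Y] by (simp add: power2_norm_eq_inner)
  also have "\<dots> \<le> norm (mat 1 :: real^'m^'m) * norm (Y ** transpose Y)"
    by (rule norm_cauchy_schwarz)
  finally show ?thesis .
qed

section \<open>Rank-one matrices, reflections and aligned representatives of orbits\<close>

definition outer :: "real^'m \<Rightarrow> real^'n \<Rightarrow> real^'n^'m" where
  "outer u v = (\<chi> i j. u$i * v$j)"

lemma outer_mult_vec: "outer u v *v w = (v \<bullet> w) *\<^sub>R u"
  by (simp add: outer_def matrix_vector_mult_def inner_vec_def vec_eq_iff sum_distrib_right
      sum_distrib_left mult_ac)

lemma transpose_outer: "transpose (outer u v) = outer v u"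
  by (simp add: outer_def transpose_def vec_eq_iff mult.commute)

lemma outer_mult_outer: "outer u v ** outer w x = (v \<bullet> w) *\<^sub>R outer u x"
  by (simp add: outer_def matrix_matrix_mult_def inner_vec_def vec_eq_iff sum_distrib_right
      sum_distrib_left mult_ac)

lemma inner_outer: "C \<bullet> outer u v = u \<bullet> (C *v v)"
  by (simp add: outer_def matrix_vector_mult_def inner_vec_def sum_distrib_left mult_ac)

lemma mult_transpose_eq_sum_outer:
  "\<theta> ** transpose \<theta> = (\<Sum>k\<in>UNIV. outer (column k \<theta>) (column k (\<theta> :: real^'n^'m)))"
  by (simp add: outer_def matrix_matrix_mult_def transpose_def column_def vec_eq_iff sum_component)

text \<open>At \<open>v = 0\<close> the subtracted term vanishes and the identity remains, so
  orthogonality needs no side condition on \<open>v\<close>.\<close>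

definition householder :: "real^'n \<Rightarrow> real^'n^'n" where
  "householder v = mat 1 - (2 / (v \<bullet> v)) *\<^sub>R outer v v"

lemma orthogonal_householder: "orthogonal_matrix (householder v)"
proof (cases "v = 0")
  case True
  then show ?thesis by (simp add: householder_def orthogonal_matrix_id)
next
  case False
  have "transpose (householder v) = householder v"
    by (simp add: householder_def matrix_mult_linear_simps transpose_outer)
  moreover have "householder v ** householder v = mat 1"
    using False
    by (simp add: householder_def matrix_mult_linear_simps outer_mult_outer algebra_simps
        flip: scaleR_add_left)
  ultimately show ?thesis by (simp add: orthogonal_matrix_def)
qed

text \<open>At \<open>s = a / k\<close> with \<open>k > b\<close> the inequality becomes
  \<open>a^2 k <= a^2 b\<close>, which is impossible for nonzero \<open>a\<close>. This turns
  optimality along a one-parameter family into an equation.\<close>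

lemma linear_le_quadratic_imp_zero:
  fixes a b :: real
  assumes "\<And>s. s * a \<le> s\<^sup>2 * b"
  shows "a = 0"
proof (rule ccontr)
  assume "a \<noteq> 0"
  define k where "k = \<bar>b\<bar> + 1"
  have k: "k > 0" "b < k" by (auto simp: k_def)
  have "a\<^sup>2 / k \<le> a\<^sup>2 * b / k\<^sup>2"
    using assms[of "a / k"] by (simp add: power2_eq_square)
  then have "a\<^sup>2 * k \<le> a\<^sup>2 * b"
    using k by (simp add: field_simps power2_eq_square)
  with k \<open>a \<noteq> 0\<close> show False by simp
qed

text \<open>Testing optimality of the identity against a single Householder reflection gives
  nonnegativity; testing against products of two reflections in nearby hyperplanes, which are small
  rotations, gives symmetry.\<close>

lemma inner_orthogonal_max_imp_psd:
  fixes C :: "real^'n^'n"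
  assumes max: "\<And>R. orthogonal_matrix R \<Longrightarrow> C \<bullet> R \<le> C \<bullet> mat 1"
  shows "positive_semidefinite C"
proof -
  have nonneg: "0 \<le> v \<bullet> (C *v v)" for v
  proof (cases "v = 0")
    case False
    then have pos: "v \<bullet> v > 0" by simp
    have "0 \<le> (2 / (v \<bullet> v)) * (v \<bullet> (C *v v))"
      using max[OF orthogonal_householder[of v]]
      by (simp add: householder_def inner_diff_right inner_outer)
    then show ?thesis using pos by (simp add: zero_le_divide_iff)
  qed simp
  have sym: "C$i$j = C$j$i" for i j
  proof (cases "i = j")
    case False
    have "s * (C$i$j - C$j$i) \<le> s\<^sup>2 * (C$i$i + C$j$j)" for s
    proof -
      let ?u = "axis i 1 :: real^'n" and ?v = "axis i 1 + s *\<^sub>R axis j 1 :: real^'n"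
      have in_axis: "axis k 1 \<bullet> (C *v axis l 1) = C$k$l" for k l :: 'n
        by (simp add: inner_axis' matrix_vector_mul_component inner_axis)
      have axis: "axis i (1::real) \<bullet> axis i 1 = 1" "axis j (1::real) \<bullet> axis j 1 = 1"
          "axis i (1::real) \<bullet> axis j 1 = 0" "axis j (1::real) \<bullet> axis i 1 = 0"
        using False by (auto simp: inner_axis_axis)
      have u: "?u \<bullet> ?u = 1" "?u \<bullet> ?v = 1" "?v \<bullet> ?v = 1 + s\<^sup>2"
        by (simp_all add: axis inner_add_left inner_add_right power2_eq_square)
      have pos: "1 + s\<^sup>2 > 0" by (simp add: add_pos_nonneg)
      have "C \<bullet> (householder ?u ** householder ?v) \<le> C \<bullet> mat 1"
        by (intro max orthogonal_matrix_mul orthogonal_householder)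
      moreover have "householder ?u ** householder ?v = mat 1 - 2 *\<^sub>R outer ?u ?u
          - (2 / (1 + s\<^sup>2)) *\<^sub>R outer ?v ?v + (4 / (1 + s\<^sup>2)) *\<^sub>R outer ?u ?v"
        unfolding householder_def u matrix_mult_linear_simps outer_mult_outer
        by (simp add: algebra_simps)
      ultimately have "4 / (1 + s\<^sup>2) * (?u \<bullet> (C *v ?v))
          \<le> 2 * (?u \<bullet> (C *v ?u)) + 2 / (1 + s\<^sup>2) * (?v \<bullet> (C *v ?v))"
        by (simp only: inner_diff_right inner_add_right inner_scaleR_right inner_outer)
      moreover have "4 * x \<le> d * (2 * y) + 2 * z"
        if "4 / d * x \<le> 2 * y + 2 / d * z" "d > 0" for x y z d :: real
        using that by (simp add: field_simps)
      ultimately have ineq: "4 * (?u \<bullet> (C *v ?v))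
          \<le> (1 + s\<^sup>2) * (2 * (?u \<bullet> (C *v ?u))) + 2 * (?v \<bullet> (C *v ?v))"
        using pos by blast
      have entries: "?u \<bullet> (C *v ?u) = C$i$i" "?u \<bullet> (C *v ?v) = C$i$i + s * C$i$j"
          "?v \<bullet> (C *v ?v) = C$i$i + s * C$i$j + s * (C$j$i + s * C$j$j)"
        by (simp_all add: in_axis matrix_vector_right_distrib matrix_vector_mult_scaleR
            inner_add_left inner_add_right distrib_left)
      \<comment> \<open>The constant terms cancel; the part linear in \<open>s\<close> leaves
        \<open>C$i$j - C$j$i\<close>, and what remains is quadratic in \<open>s\<close>.\<close>
      show ?thesis
        using ineq unfolding entries by (simp add: algebra_simps power2_eq_square)
    qed
    from linear_le_quadratic_imp_zero[OF this] show ?thesis by simp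
  qed simp
  have "transpose C = C"
    unfolding vec_eq_iff transpose_def vec_lambda_beta using sym by blast
  with nonneg show ?thesis
    by (simp add: positive_semidefinite_def)
qed

text \<open>Closedness comes from the defining equation. Boundedness holds because the squared norm
  of \<open>Q\<close> is the trace of \<open>Q Q^T\<close>, so every orthogonal matrix has the norm
  of the identity.\<close>

lemma compact_orthogonal_matrices: "compact {Q :: real^'n^'n. orthogonal_matrix Q}"
proof -
  have eq: "{Q :: real^'n^'n. orthogonal_matrix Q} = {Q. transpose Q ** Q = mat 1}"
    by (auto simp: orthogonal_matrix)
  have "closed {Q :: real^'n^'n. transpose Q ** Q = mat 1}"
    by (intro closed_Collect_eq continuous_intros)
  moreover have "(norm Q)\<^sup>2 = (norm (mat 1 :: real^'n^'n))\<^sup>2"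
    if "orthogonal_matrix Q" for Q :: "real^'n^'n"
    using that inner_matrix_mult_right[of "mat 1" Q Q] inner_matrix_mult_right[of "mat 1" "mat 1" "mat 1"]
    by (simp add: orthogonal_matrix_def power2_norm_eq_inner transpose_mat)
  then have "norm Q \<le> norm (mat 1 :: real^'n^'n)" if "orthogonal_matrix Q" for Q :: "real^'n^'n"
    using that by (metis norm_ge_zero order_refl power2_eq_imp_eq)
  then have "bounded {Q :: real^'n^'n. orthogonal_matrix Q}"
    by (intro boundedI) simp
  ultimately show ?thesis by (simp add: compact_eq_bounded_closed eq)
qed

text \<open>An orthogonal Procrustes argument: \<open>Q\<close> maximizes the inner product of
  \<open>Y\<close> and \<open>Z Q\<close> over the compact orthogonal group. Comparing
  \<open>Q\<close> with all products \<open>Q R\<close> shows that the identity maximizes the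
  pairing with \<open>(Z Q)^T Y\<close>, and this matrix is therefore positive semidefinite.\<close>

lemma exists_aligned:
  fixes Y Z :: "real^'r^'p"
  obtains Q where "orthogonal_matrix Q" "positive_semidefinite (transpose Y ** (Z ** Q))"
proof -
  have "continuous_on {Q. orthogonal_matrix Q} (\<lambda>Q. Y \<bullet> (Z ** Q))"
    by (intro continuous_intros)
  then obtain Q where Q: "orthogonal_matrix Q"
      and max: "\<And>R. orthogonal_matrix R \<Longrightarrow> Y \<bullet> (Z ** R) \<le> Y \<bullet> (Z ** Q)"
    using continuous_attains_sup[OF compact_orthogonal_matrices, of "\<lambda>Q. Y \<bullet> (Z ** Q)"]
      orthogonal_matrix_id by auto
  have "(transpose (Z ** Q) ** Y) \<bullet> R \<le> (transpose (Z ** Q) ** Y) \<bullet> mat 1"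
    if R: "orthogonal_matrix R" for R
    using max[OF orthogonal_matrix_mul[OF Q R]]
    by (simp add: inner_matrix_mult_left[of "Z ** Q", symmetric] inner_commute[of _ R]
        inner_commute[of _ "mat 1"] inner_commute[of Y] matrix_mul_assoc
        flip: inner_matrix_mult_left)
  then have "positive_semidefinite (transpose (Z ** Q) ** Y)"
    by (rule inner_orthogonal_max_imp_psd)
  then have "positive_semidefinite (transpose Y ** (Z ** Q))"
    by (metis positive_semidefinite_def matrix_transpose_mul transpose_transpose)
  with Q show ?thesis by (rule that)
qed

section \<open>Rank, horizontal vectors and orbits\<close>

lemma rank_le_card:
  fixes A :: "real^'n^'m"
  assumes "range ((*v) A) \<subseteq> span B" "finite B"
  shows "rank A \<le> card B"
  unfolding rank_dim_range using assms by (rule dim_le_card)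

lemma rank_add_le: "rank (A + B) \<le> rank A + rank (B :: real^'n^'m)"
proof -
  obtain S where S: "range ((*v) A) \<subseteq> span S" "finite S" "card S = rank A"
    using basis_exists[of "range ((*v) A)"] rank_dim_range[of A] independent_imp_finite by metis
  obtain T where T: "range ((*v) B) \<subseteq> span T" "finite T" "card T = rank B"
    using basis_exists[of "range ((*v) B)"] rank_dim_range[of B] independent_imp_finite by metis
  have "A *v x + B *v x \<in> span (S \<union> T)" for x
    using S(1) T(1) span_mono[of S "S \<union> T"] span_mono[of T "S \<union> T"]
    by (intro span_add) auto
  then have "rank (A + B) \<le> card (S \<union> T)"
    using S(2) T(2) by (intro rank_le_card) (auto simp: matrix_vector_mult_add_rdistrib)
  also have "\<dots> \<le> rank A + rank B"
    using card_Un_le[of S T] S(3) T(3) by simp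
  finally show ?thesis .
qed

lemma rank_outer_le: "rank (outer u v) \<le> 1"
proof -
  have "range ((*v) (outer u v)) \<subseteq> span {u}"
    by (auto simp: outer_mult_vec span_base span_scale)
  then have "rank (outer u v) \<le> card {u}" by (rule rank_le_card) simp
  then show ?thesis by simp
qed

lemma full_column_rank_iff: "Y \<in> full_column_rank \<longleftrightarrow> (\<forall>v. Y *v v = 0 \<longrightarrow> v = 0)"
  by (simp add: full_column_rank_def full_rank_injective linear_injective_0)

lemma full_column_rank_if_rank_mult_transpose:
  fixes Y :: "real^'r^'p"
  assumes "rank (Y ** transpose Y) = CARD('r)"
  shows "Y \<in> full_column_rank"
  using rank_mul_le_left[of Y "transpose Y"] rank_bound[of Y] assms
  by (simp add: full_column_rank_def)

lemma mult_transpose_eq_0D: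
  assumes "Y \<in> full_column_rank" "Y ** transpose \<theta> = 0"
  shows "\<theta> = 0"
proof -
  have "Y *v (transpose \<theta> *v x) = 0" for x
    using assms(2) by (simp add: matrix_vector_mul_assoc del: transpose_matrix_vector)
  then have "transpose \<theta> = 0"
    using assms(1) by (simp add: full_column_rank_iff matrix_eq del: transpose_matrix_vector)
  then have "transpose (transpose \<theta>) = transpose 0" by (rule arg_cong)
  then show ?thesis by (simp add: matrix_mult_linear_simps)
qed

lemma horizontal_iff: "\<theta> \<in> horizontal Y \<longleftrightarrow> transpose (transpose Y ** \<theta>) = transpose Y ** \<theta>"
  by (simp add: horizontal_def)

text \<open>With \<open>P = Y \<theta>^T\<close>, expanding the square of \<open>P + P^T\<close>
  gives twice the square of \<open>P\<close> plus twice the cross term of \<open>P\<close> and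
  \<open>P^T\<close>. The cross term equals the pairing of \<open>Y^T \<theta>\<close> with its own
  transpose, which for horizontal \<open>\<theta>\<close> is a squared norm.\<close>

lemma norm_symmetrized_horizontal_ge:
  assumes "\<theta> \<in> horizontal Y"
  shows "2 * (norm (Y ** transpose \<theta>))\<^sup>2 \<le> (norm (Y ** transpose \<theta> + \<theta> ** transpose Y))\<^sup>2"
proof -
  let ?P = "Y ** transpose \<theta>" and ?A = "transpose Y ** \<theta>"
  have tr: "\<theta> ** transpose Y = transpose ?P"
    by (simp add: matrix_transpose_mul)
  have "?P \<bullet> (\<theta> ** transpose Y) = (?A ** transpose Y) \<bullet> transpose \<theta>"
    by (simp add: inner_matrix_mult_left matrix_mul_assoc inner_commute)
  also have "\<dots> = ?A \<bullet> transpose ?A"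
    by (simp add: inner_matrix_mult_right matrix_transpose_mul)
  also have "\<dots> = ?A \<bullet> ?A"
    using assms by (simp add: horizontal_iff)
  finally have "?P \<bullet> transpose ?P \<ge> 0"
    using inner_ge_zero[of ?A] unfolding tr by linarith
  moreover have "transpose ?P \<bullet> transpose ?P = ?P \<bullet> ?P"
    by (rule inner_transpose)
  ultimately show ?thesis
    unfolding tr power2_norm_eq_inner
    by (simp add: inner_add_left inner_add_right inner_commute[of "transpose ?P" ?P])
qed

lemma inner_psd_mult_nonneg:
  fixes B :: "real^'k^'n"
  assumes "positive_semidefinite C"
  shows "0 \<le> B \<bullet> (C ** B)"
proof -
  have "B \<bullet> (C ** B) = (\<Sum>j\<in>UNIV. column j B \<bullet> (C *v column j B))"
    unfolding inner_matrix
    by (subst sum.swap)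
      (simp add: inner_vec_def column_def matrix_vector_mult_def matrix_matrix_mult_def)
  then show ?thesis
    using assms by (simp add: positive_semidefinite_def sum_nonneg)
qed

lemma orbit_self: "Y \<in> orbit Y"
  unfolding orbit_def using orthogonal_matrix_id by force

lemma mult_orthogonal_mult_transpose:
  assumes "orthogonal_matrix Q"
  shows "(Y ** Q) ** transpose (Y ** Q) = Y ** transpose (Y :: real^'r^'p)"
proof -
  have "(Y ** Q) ** transpose (Y ** Q) = Y ** (Q ** transpose Q) ** transpose Y"
    by (simp add: matrix_transpose_mul matrix_mul_assoc)
  then show ?thesis using assms by (simp add: orthogonal_matrix_def)
qed

lemma mult_transpose_eq_if_in_orbit:
  assumes "Z \<in> orbit Y"
  shows "Z ** transpose Z = Y ** transpose Y"
  using assms mult_orthogonal_mult_transpose by (auto simp: orbit_def)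

lemma orbit_mult_orthogonal:
  assumes Q: "orthogonal_matrix Q"
  shows "orbit (Y ** Q) = orbit (Y :: real^'r^'p)"
proof
  show "orbit (Y ** Q) \<subseteq> orbit Y"
    using orthogonal_matrix_mul[OF Q] by (auto simp: orbit_def simp flip: matrix_mul_assoc)
  have "Y ** R = (Y ** Q) ** (transpose Q ** R)" for R :: "real^'r^'r"
  proof -
    have "(Y ** Q) ** (transpose Q ** R) = Y ** (Q ** transpose Q) ** R"
      by (simp add: matrix_mul_assoc)
    then show ?thesis using Q by (simp add: orthogonal_matrix_def)
  qed
  moreover have "orthogonal_matrix (transpose Q ** R)" if "orthogonal_matrix R" for R
    using Q that by (simp add: orthogonal_matrix_mul orthogonal_matrix_transpose)
  ultimately show "orbit Y \<subseteq> orbit (Y ** Q)"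
    unfolding orbit_def by blast
qed

lemma full_column_rank_mult_orthogonal:
  assumes "orthogonal_matrix Q" "Y \<in> full_column_rank"
  shows "Y ** Q \<in> full_column_rank"
  unfolding full_column_rank_iff
proof (intro allI impI)
  fix v assume "(Y ** Q) *v v = 0"
  then have "Q *v v = 0"
    using assms(2) by (simp add: full_column_rank_iff flip: matrix_vector_mul_assoc)
  then have "(transpose Q ** Q) *v v = 0"
    by (simp flip: matrix_vector_mul_assoc)
  then show "v = 0" using assms(1) by (simp add: orthogonal_matrix)
qed

section \<open>Geodesic convexity of sublevel sets\<close>

text \<open>Here \<open>A\<close> and \<open>B\<close> stand for the deviations
  \<open>Y Y^T - X\<close> at the two ends, \<open>E\<close> for \<open>D D^T\<close> and
  \<open>q\<close> for the squared length of the segment. The convex combination of \<open>A\<close>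
  and \<open>B\<close> gains \<open>t (1 - t)\<close> times the squared distance of \<open>A\<close>
  and \<open>B\<close>, and the bound by \<open>c * q\<close> makes this gain large enough to absorb
  the perturbation by \<open>E\<close>.\<close>

lemma norm_segment_less:
  fixes A B E :: "'a::real_inner"
  assumes A: "norm A < \<epsilon>" and B: "norm B < \<epsilon>" and t: "0 \<le> t" "t \<le> 1"
    and c: "\<epsilon> \<le> c / 4" "c * q \<le> (norm (A - B))\<^sup>2" and E: "norm E \<le> q"
  shows "norm ((1 - t) *\<^sub>R A + t *\<^sub>R B - (t * (1 - t)) *\<^sub>R E) < \<epsilon>"
proof -
  define N where "N = (1 - t) *\<^sub>R A + t *\<^sub>R B"
  define s where "s = t * (1 - t)"
  have s: "0 \<le> s" "s \<le> 1" using t by (auto simp: s_def intro: mult_le_one)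
  have \<epsilon>: "\<epsilon> > 0" using A norm_ge_zero[of A] by linarith
  have q: "0 \<le> q" using E norm_ge_zero[of E] by linarith
  have "norm (A - B) \<le> 2 * \<epsilon>"
    using norm_triangle_ineq4[of A B] A B by linarith
  then have "(norm (A - B))\<^sup>2 \<le> (2 * \<epsilon>)\<^sup>2" by (intro power_mono) auto
  moreover have "4 * \<epsilon> * q \<le> c * q" using c(1) q by (intro mult_right_mono) auto
  ultimately have "\<epsilon> * q \<le> \<epsilon> * \<epsilon>" using c(2) by (simp add: power2_eq_square)
  then have q\<epsilon>: "q \<le> \<epsilon>" using \<epsilon> by simp
  have "norm N \<le> (1 - t) * norm A + t * norm B"
    unfolding N_def using t norm_triangle_ineq[of "(1 - t) *\<^sub>R A" "t *\<^sub>R B"] by simp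
  also have "\<dots> \<le> (1 - t) * \<epsilon> + t * \<epsilon>"
    using A B t by (intro add_mono mult_left_mono) auto
  finally have N\<epsilon>: "norm N \<le> \<epsilon>" by (simp add: algebra_simps)
  have NN: "(norm N)\<^sup>2 = (1 - t) * (norm A)\<^sup>2 + t * (norm B)\<^sup>2 - s * (norm (A - B))\<^sup>2"
    unfolding N_def s_def power2_norm_eq_inner
    by (simp add: inner_add_left inner_add_right inner_diff_left inner_diff_right
        inner_commute[of B A] algebra_simps power2_eq_square)
  have "\<bar>N \<bullet> E\<bar> \<le> \<epsilon> * q"
    using Cauchy_Schwarz_ineq2[of N E] mult_mono[OF N\<epsilon> E] \<epsilon> by simp
  then have "s * (- (N \<bullet> E)) \<le> s * (\<epsilon> * q)" using s by (intro mult_left_mono) auto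
  then have cross: "- (s * (N \<bullet> E)) \<le> s * (\<epsilon> * q)" by simp
  have "(norm E)\<^sup>2 \<le> \<epsilon> * q"
    unfolding power2_eq_square using E q\<epsilon> \<epsilon> by (intro mult_mono) auto
  then have "s * (s * (norm E)\<^sup>2) \<le> 1 * (s * (\<epsilon> * q))"
    using s by (intro mult_mono mult_left_mono) auto
  then have quad: "s * (s * (norm E)\<^sup>2) \<le> s * (\<epsilon> * q)" by simp
  have "s * (4 * (\<epsilon> * q)) \<le> s * (norm (A - B))\<^sup>2"
    using s c(2) \<open>4 * \<epsilon> * q \<le> c * q\<close> by (intro mult_left_mono) auto
  then have gain: "4 * (s * (\<epsilon> * q)) \<le> s * (norm (A - B))\<^sup>2" by simp
  have nonneg: "0 \<le> s * (\<epsilon> * q)" using s q \<epsilon> by simp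
  have expand: "(norm (N - s *\<^sub>R E))\<^sup>2 = (norm N)\<^sup>2 - 2 * (s * (N \<bullet> E)) + s * (s * (norm E)\<^sup>2)"
    unfolding power2_norm_eq_inner
    by (simp add: inner_diff_left inner_diff_right inner_commute[of E N] right_diff_distrib)
  have "(norm A)\<^sup>2 < \<epsilon>\<^sup>2" "(norm B)\<^sup>2 < \<epsilon>\<^sup>2"
    using A B by (auto intro: power_strict_mono)
  then have avg: "(1 - t) * (norm A)\<^sup>2 + t * (norm B)\<^sup>2 < \<epsilon>\<^sup>2"
    using t convex_bound_lt[of "(norm A)\<^sup>2" "\<epsilon>\<^sup>2" "(norm B)\<^sup>2" "1 - t" t] by simp
  \<comment> \<open>With \<open>m = s * (\<epsilon> * q)\<close>, the cross term costs at most
    \<open>2 * m\<close> and the quadratic term at most \<open>m\<close>, against a gain of at least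
    \<open>4 * m\<close>.\<close>
  have combine: "x < e" if "x = n - 2 * i + w" "n = y - g" "y < e" "- i \<le> m" "w \<le> m" "4 * m \<le> g" "0 \<le> m"
    for x n i w y g e m :: real
    using that by linarith
  have "(norm (N - s *\<^sub>R E))\<^sup>2 < \<epsilon>\<^sup>2"
    by (rule combine[OF expand NN avg cross quad gain nonneg])
  then have "norm (N - s *\<^sub>R E) < \<epsilon>"
    by (rule power2_less_imp_less) (use \<epsilon> in simp)
  then show ?thesis
    by (simp only: N_def s_def)
qed

text \<open>Moving along \<open>D\<close> changes \<open>Y^T D\<close> by a multiple of the
  symmetric matrix \<open>D^T D\<close>, so a line that starts horizontally stays horizontal. Its
  Euclidean acceleration is zero, hence so is the projected one.\<close>

lemma geodesic_segment_line:
  assumes "\<And>t. t \<in> {0..1} \<Longrightarrow> Y + t *\<^sub>R D \<in> full_column_rank" and D: "D \<in> horizontal Y"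
  shows "geodesic_segment (\<lambda>t. orbit (Y + t *\<^sub>R D))"
proof -
  have "D \<in> horizontal (Y + t *\<^sub>R D)" for t
    using D by (simp add: horizontal_iff matrix_mult_linear_simps matrix_transpose_mul)
  moreover have "horizontal_proj Z 0 = 0" for Z :: "real^'a^'b"
    by (rule horizontal_proj_unique) (auto simp: subspace_0 subspace_horizontal)
  moreover have "((\<lambda>t. Y + t *\<^sub>R D) has_vector_derivative D) (at t within {0..1})" for t
    by (auto intro!: derivative_eq_intros)
  moreover have "((\<lambda>t. D) has_vector_derivative 0) (at t within {0..1})" for t :: real
    by (rule has_vector_derivative_const)
  ultimately show ?thesis
    unfolding geodesic_segment_def using assms(1)
    by (intro exI[of _ "\<lambda>t. Y + t *\<^sub>R D"] exI[of _ "\<lambda>_. D"] exI[of _ "\<lambda>_. 0"]) auto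
qed

text \<open>Sublevel sets of \<open>\<parallel>Y Y\<^sup>T - X\<parallel>\<close> replace metric balls: along a segment between
  aligned representatives, the squared norm is a convex quadratic up to a term of order
  \<open>\<parallel>Z - Y\<parallel>\<^sup>4\<close>.\<close>

lemma geodesically_convex_sublevel:
  fixes X :: "real^'p^'p"
  assumes \<epsilon>: "\<epsilon> \<le> c / 4"
    and c: "\<And>Y \<theta> :: real^'r^'p. dist (Y ** transpose Y) X < \<epsilon> \<Longrightarrow>
              c * (norm \<theta>)\<^sup>2 \<le> (norm (Y ** transpose \<theta>))\<^sup>2"
  shows "geodesically_convex
           (orbit ` {Y :: real^'r^'p. Y \<in> full_column_rank \<and> dist (Y ** transpose Y) X < \<epsilon>})"
    (is "geodesically_convex ?U")
  unfolding geodesically_convex_def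
proof (intro conjI ballI)
  show "?U \<subseteq> orbit ` full_column_rank" by auto
next
  fix A B assume "A \<in> ?U" "B \<in> ?U"
  then obtain Y Z0 :: "real^'r^'p" where AY: "A = orbit Y" and BZ0: "B = orbit Z0"
    and Y: "Y \<in> full_column_rank" and Z0: "Z0 \<in> full_column_rank"
    and dY: "dist (Y ** transpose Y) X < \<epsilon>" and dZ0: "dist (Z0 ** transpose Z0) X < \<epsilon>"
    by blast
  obtain Q where Q: "orthogonal_matrix Q" and psd: "positive_semidefinite (transpose Y ** (Z0 ** Q))"
    by (rule exists_aligned)
  define Z where "Z = Z0 ** Q"
  define D where "D = Z - Y"
  have Z: "Z \<in> full_column_rank" and BZ: "B = orbit Z" and dZ: "dist (Z ** transpose Z) X < \<epsilon>"
    using Q Z0 BZ0 dZ0 unfolding Z_def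
    by (simp_all add: full_column_rank_mult_orthogonal orbit_mult_orthogonal
        mult_orthogonal_mult_transpose)
  have psd: "positive_semidefinite (transpose Y ** Z)" using psd by (simp add: Z_def)
  then have sym: "transpose Z ** Y = transpose Y ** Z"
    by (simp add: positive_semidefinite_def matrix_transpose_mul)
  have hor: "D \<in> horizontal Y" "D \<in> horizontal (Y + Z)"
    by (simp_all add: horizontal_iff D_def matrix_mult_linear_simps matrix_transpose_mul sym)
  \<comment> \<open>Alignment makes the inner product of \<open>Y v\<close> and \<open>Z v\<close>
    nonnegative, so the two terms of the combination cannot cancel; a kernel vector of an
    intermediate point is a kernel vector of \<open>Y\<close> or of \<open>Z\<close>.\<close>
  have full: "Y + t *\<^sub>R D \<in> full_column_rank" if t: "0 \<le> t" "t \<le> 1" for t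
    unfolding full_column_rank_iff
  proof (intro allI impI)
    fix v assume v: "(Y + t *\<^sub>R D) *v v = 0"
    have "Y + t *\<^sub>R D = (1 - t) *\<^sub>R Y + t *\<^sub>R Z"
      by (simp add: D_def algebra_simps)
    then have eq: "(1 - t) *\<^sub>R (Y *v v) + t *\<^sub>R (Z *v v) = 0"
      using v by (simp add: matrix_vector_mult_add_rdistrib scaleR_matrix_vector_assoc)
    have "0 \<le> (Y *v v) \<bullet> (Z *v v)"
    proof -
      have "v \<bullet> ((transpose Y ** Z) *v v) = (v v* transpose Y) \<bullet> (Z *v v)"
        by (simp only: dot_lmul_matrix matrix_vector_mul_assoc)
      moreover have "0 \<le> v \<bullet> ((transpose Y ** Z) *v v)"
        using psd by (simp add: positive_semidefinite_def)
      ultimately show ?thesis by simp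
    qed
    then have "0 \<le> (1 - t) * t * ((Y *v v) \<bullet> (Z *v v))"
      using t by simp
    moreover have "0 = (norm ((1 - t) *\<^sub>R (Y *v v) + t *\<^sub>R (Z *v v)))\<^sup>2"
      using eq by simp
    then have "0 = ((1 - t) * norm (Y *v v))\<^sup>2 + (t * norm (Z *v v))\<^sup>2
        + 2 * ((1 - t) * t * ((Y *v v) \<bullet> (Z *v v)))"
      unfolding power_mult_distrib power2_norm_eq_inner
      by (simp add: inner_add_left inner_add_right inner_commute[of "Z *v v" "Y *v v"]
          power2_eq_square algebra_simps)
    ultimately have "((1 - t) * norm (Y *v v))\<^sup>2 + (t * norm (Z *v v))\<^sup>2 \<le> 0"
      by linarith
    then have "(1 - t) * norm (Y *v v) = 0" "t * norm (Z *v v) = 0"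
      by (simp_all add: sum_power2_le_zero_iff)
    then have "Y *v v = 0 \<or> Z *v v = 0" by auto
    then show "v = 0" using Y Z by (auto simp: full_column_rank_iff)
  qed
  have near: "dist ((Y + t *\<^sub>R D) ** transpose (Y + t *\<^sub>R D)) X < \<epsilon>" if t: "0 \<le> t" "t \<le> 1" for t
  proof -
    let ?P = "(Y + Z) ** transpose D"
    \<comment> \<open>Since \<open>D\<close> is horizontal at \<open>Y + Z\<close>, this identity
      bounds the change of \<open>Y Y^T\<close> between the end points from below by
      \<open>?P\<close>. In \<open>?P\<close> the cross term of \<open>Y D^T\<close> and
      \<open>Z D^T\<close> is nonnegative by alignment, so both ends contribute \<open>c\<close>
      times the squared norm of \<open>D\<close>.\<close>
    have sum_eq: "?P + D ** transpose (Y + Z) = 2 *\<^sub>R (Z ** transpose Z - Y ** transpose Y)"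
      by (simp add: D_def matrix_mult_linear_simps algebra_simps scaleR_2)
    have "(Y ** transpose D) \<bullet> (Z ** transpose D) = transpose D \<bullet> ((transpose Y ** Z) ** transpose D)"
      by (simp add: inner_matrix_mult_left matrix_mul_assoc)
    then have "0 \<le> (Y ** transpose D) \<bullet> (Z ** transpose D)"
      using inner_psd_mult_nonneg[OF psd] by metis
    moreover have "?P = Y ** transpose D + Z ** transpose D"
      by (simp add: matrix_mult_linear_simps)
    ultimately have "(norm (Y ** transpose D))\<^sup>2 + (norm (Z ** transpose D))\<^sup>2 \<le> (norm ?P)\<^sup>2"
      by (simp add: power2_norm_eq_inner inner_add_left inner_add_right
          inner_commute[of "Z ** transpose D" "Y ** transpose D"])
    then have "2 * (2 * (c * (norm D)\<^sup>2)) \<le> 2 * (norm ?P)\<^sup>2"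
      using c[OF dY, of D] c[OF dZ, of D] by linarith
    also have "\<dots> \<le> (norm (?P + D ** transpose (Y + Z)))\<^sup>2"
      by (rule norm_symmetrized_horizontal_ge[OF hor(2)])
    also have "\<dots> = 4 * (norm (Z ** transpose Z - Y ** transpose Y))\<^sup>2"
      unfolding sum_eq by (simp add: power_mult_distrib)
    finally have "c * (norm D)\<^sup>2 \<le> (norm (Z ** transpose Z - Y ** transpose Y))\<^sup>2"
      by linarith
    then have lower: "c * (norm D)\<^sup>2
        \<le> (norm ((Y ** transpose Y - X) - (Z ** transpose Z - X)))\<^sup>2"
      by (simp add: norm_minus_commute)
    \<comment> \<open>The products \<open>Y Y^T\<close> along the segment deviate from linear
      interpolation by exactly \<open>t (1 - t) D D^T\<close>.\<close>
    have "(Y + t *\<^sub>R D) ** transpose (Y + t *\<^sub>R D) - X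
        = (1 - t) *\<^sub>R (Y ** transpose Y - X) + t *\<^sub>R (Z ** transpose Z - X)
          - (t * (1 - t)) *\<^sub>R (D ** transpose D)"
      by (simp add: D_def matrix_mult_linear_simps algebra_simps)
    then show ?thesis
      using norm_segment_less[OF dY[unfolded dist_norm] dZ[unfolded dist_norm] t \<epsilon> lower
          norm_matrix_mult_transpose_le]
      by (simp add: dist_norm)
  qed
  show "\<exists>c. geodesic_segment c \<and> c 0 = A \<and> c 1 = B \<and> c ` {0..1} \<subseteq> ?U"
  proof (intro exI conjI)
    show "geodesic_segment (\<lambda>t. orbit (Y + t *\<^sub>R D))"
      using full hor(1) by (intro geodesic_segment_line) auto
    show "orbit (Y + 0 *\<^sub>R D) = A" "orbit (Y + 1 *\<^sub>R D) = B"
      by (simp_all add: AY BZ D_def)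
    show "(\<lambda>t. orbit (Y + t *\<^sub>R D)) ` {0..1} \<subseteq> ?U"
      using full near by auto
  qed
qed

section \<open>Riemannian gradient and Hessian of the quotient function\<close>

text \<open>Turns a derivative functional into the Euclidean gradient. The map is bounded linear in
  \<open>L\<close>, so differentiating the gradient reduces to differentiating
  \<open>f'\<close>.\<close>

definition riesz_vector :: "('a::euclidean_space \<Rightarrow>\<^sub>L real) \<Rightarrow> 'a" where
  "riesz_vector L = (\<Sum>b\<in>Basis. L b *\<^sub>R b)"

lemma inner_riesz_vector: "riesz_vector L \<bullet> x = L x"
proof -
  have "L x = L (\<Sum>b\<in>Basis. (x \<bullet> b) *\<^sub>R b)"
    by (simp only: euclidean_representation)
  also have "\<dots> = (\<Sum>b\<in>Basis. (x \<bullet> b) * L b)"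
    by (simp add: blinfun.sum_right blinfun.scaleR_right)
  finally show ?thesis
    unfolding riesz_vector_def inner_sum_left inner_scaleR_left
    by (simp add: inner_commute mult.commute)
qed

lemma bounded_linear_riesz_vector: "bounded_linear riesz_vector"
  unfolding riesz_vector_def
  by (intro bounded_linear_sum bounded_linear_scaleR_left[THEN bounded_linear_compose]
      bounded_linear_apply_blinfun)

context
  fixes f :: "real^'p^'p \<Rightarrow> real"
    and f' :: "real^'p^'p \<Rightarrow> (real^'p^'p) \<Rightarrow>\<^sub>L real"
    and f'' :: "real^'p^'p \<Rightarrow> (real^'p^'p) \<Rightarrow>\<^sub>L ((real^'p^'p) \<Rightarrow>\<^sub>L real)"
  assumes f': "\<And>X. (f has_derivative blinfun_apply (f' X)) (at X)"
    and f'': "\<And>X. (f' has_derivative blinfun_apply (f'' X)) (at X)"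
begin

lemma euclidean_hessian_eq: "euclidean_hessian f X G H = f'' X G H"
proof -
  have "(\<lambda>Z. frechet_derivative f (at Z) H) = (\<lambda>Z. f' Z H)"
    by (simp flip: frechet_derivative_at[OF f'])
  moreover have "((\<lambda>Z. f' Z H) has_derivative (\<lambda>G. f'' X G H)) (at X)"
    using bounded_linear.has_derivative[OF blinfun.bounded_linear_left f''] .
  ultimately show ?thesis
    by (simp add: euclidean_hessian_def flip: frechet_derivative_at)
qed

lemma has_derivative_mult_transpose:
  "((\<lambda>Y. Y ** transpose Y) has_derivative (\<lambda>\<theta>. Y ** transpose \<theta> + \<theta> ** transpose Y))
     (at (Y :: real^'r^'p))"
  by (auto intro!: derivative_eq_intros)

text \<open>The adjoint of \<open>\<theta> \<mapsto> Y \<theta>^T + \<theta> Y^T\<close> sends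
  \<open>G\<close> to \<open>(G + G^T) Y\<close>. This is already horizontal, because
  \<open>Y^T (G + G^T) Y\<close> is symmetric. Uniqueness follows since the difference of two
  candidates is horizontal and orthogonal to itself.\<close>

lemma riemannian_gradient_quotient_fun:
  fixes Y :: "real^'r^'p"
  defines "G \<equiv> riesz_vector (f' (Y ** transpose Y))"
  shows "riemannian_gradient (quotient_fun f) Y = (G + transpose G) ** Y"
proof -
  have "((\<lambda>Z. f (Z ** transpose Z)) has_derivative
      (\<lambda>\<theta>. f' (Y ** transpose Y) (Y ** transpose \<theta> + \<theta> ** transpose Y))) (at Y)"
    by (rule has_derivative_compose[OF has_derivative_mult_transpose f'])
  then have D: "frechet_derivative (\<lambda>Z. quotient_fun f (orbit Z)) (at Y) \<theta>
      = f' (Y ** transpose Y) (Y ** transpose \<theta> + \<theta> ** transpose Y)" for \<theta>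
    by (simp add: quotient_fun_orbit flip: frechet_derivative_at)
  have inner: "((G + transpose G) ** Y) \<bullet> \<theta>
      = f' (Y ** transpose Y) (Y ** transpose \<theta> + \<theta> ** transpose Y)" for \<theta>
  proof -
    have "((G + transpose G) ** Y) \<bullet> \<theta> = G \<bullet> (\<theta> ** transpose Y) + G \<bullet> (Y ** transpose \<theta>)"
      by (simp add: inner_matrix_mult_right inner_add_left inner_transpose_left
          matrix_transpose_mul)
    then show ?thesis
      by (simp add: G_def inner_riesz_vector blinfun.add_right)
  qed
  have hor: "(G + transpose G) ** Y \<in> horizontal Y"
    by (simp add: horizontal_iff matrix_mult_linear_simps matrix_transpose_mul matrix_mul_assoc
        add.commute)
  show ?thesis
    unfolding riemannian_gradient_def
  proof (rule the_equality)
    show "(G + transpose G) ** Y \<in> horizontal Y \<and> (\<forall>\<theta>\<in>horizontal Y.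
        frechet_derivative (\<lambda>Z. quotient_fun f (orbit Z)) (at Y) \<theta> = ((G + transpose G) ** Y) \<bullet> \<theta>)"
      using hor by (simp add: D inner)
  next
    fix g assume g: "g \<in> horizontal Y \<and> (\<forall>\<theta>\<in>horizontal Y.
        frechet_derivative (\<lambda>Z. quotient_fun f (orbit Z)) (at Y) \<theta> = g \<bullet> \<theta>)"
    let ?d = "g - (G + transpose G) ** Y"
    have "?d \<in> horizontal Y"
      using g hor by (intro subspace_diff subspace_horizontal) auto
    then have "g \<bullet> ?d = ((G + transpose G) ** Y) \<bullet> ?d"
      using g by (simp add: D inner)
    then have "?d \<bullet> ?d = 0"
      unfolding inner_diff_left by simp
    then show "g = (G + transpose G) ** Y"
      by simp
  qed
qed

text \<open>Product rule on \<open>(G + G^T) Y\<close>: varying \<open>G\<close> yields the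
  \<open>f''\<close> term, varying \<open>Y\<close> the term in \<open>\<theta> \<theta>^T\<close>.
  Pairing with a horizontal vector removes the projection in the covariant derivative.\<close>

lemma riemannian_hessian_quotient_fun:
  fixes Y \<theta> :: "real^'r^'p"
  assumes "\<theta> \<in> horizontal Y"
  defines "X \<equiv> Y ** transpose Y" and "S \<equiv> Y ** transpose \<theta> + \<theta> ** transpose Y"
  shows "riemannian_hessian (quotient_fun f) Y \<theta> \<theta> = f'' X S S + 2 * f' X (\<theta> ** transpose \<theta>)"
proof -
  let ?G = "\<lambda>Z :: real^'r^'p. riesz_vector (f' (Z ** transpose Z))"
  let ?G' = "\<lambda>\<theta>. riesz_vector (f'' X (Y ** transpose \<theta> + \<theta> ** transpose Y))"
  have G: "(?G has_derivative ?G') (at Y)"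
    unfolding X_def
    by (rule bounded_linear.has_derivative[OF bounded_linear_riesz_vector
          has_derivative_compose[OF has_derivative_mult_transpose f'']])
  have "((\<lambda>Z. (?G Z + transpose (?G Z)) ** Z) has_derivative
      (\<lambda>\<theta>. (?G Y + transpose (?G Y)) ** \<theta> + (?G' \<theta> + transpose (?G' \<theta>)) ** Y)) (at Y)"
    by (intro derivative_intros G)
  \<comment> \<open>The gradient formula holds at every matrix, including those of deficient rank,
    so it is an equality of functions and can be differentiated.\<close>
  moreover have "riemannian_gradient (quotient_fun f) = (\<lambda>Z. (?G Z + transpose (?G Z)) ** Z)"
    by (rule ext) (rule riemannian_gradient_quotient_fun)
  ultimately have D: "frechet_derivative (riemannian_gradient (quotient_fun f)) (at Y) \<theta>
      = (?G Y + transpose (?G Y)) ** \<theta> + (?G' \<theta> + transpose (?G' \<theta>)) ** Y"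
    by (simp flip: frechet_derivative_at)
  have "riemannian_hessian (quotient_fun f) Y \<theta> \<theta>
      = ((?G Y + transpose (?G Y)) ** \<theta> + (?G' \<theta> + transpose (?G' \<theta>)) ** Y) \<bullet> \<theta>"
    by (simp only: riemannian_hessian_def covariant_derivative_def horizontal_proj_inner[OF assms(1)] D)
  also have "\<dots> = 2 * (?G Y \<bullet> (\<theta> ** transpose \<theta>)) + ?G' \<theta> \<bullet> (\<theta> ** transpose Y)
      + ?G' \<theta> \<bullet> (Y ** transpose \<theta>)"
    by (simp add: inner_matrix_mult_right inner_add_left inner_transpose_left matrix_transpose_mul)
  also have "\<dots> = f'' X S S + 2 * f' X (\<theta> ** transpose \<theta>)"
    by (simp add: inner_riesz_vector S_def X_def blinfun.add_right)
  finally show ?thesis .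
qed

section \<open>First-order optimality and uniform positivity\<close>

text \<open>Adding a multiple of \<open>\<theta> \<theta>^T\<close> could exceed the rank bound, but
  adding a multiple of a single \<open>outer u u\<close> raises the rank by at most one. Optimality
  is therefore tested column by column, and linearity of \<open>f' X\<close> sums the
  results.\<close>

lemma first_order_nonneg:
  fixes X :: "real^'p^'p" and \<theta> :: "real^'r^'p"
  assumes min: "local_minimizer_on f {X. positive_semidefinite X \<and> rank X \<le> s} X"
    and rank: "rank X < s"
  shows "0 \<le> f' X (\<theta> ** transpose \<theta>)"
proof -
  have psd: "positive_semidefinite X"
    using min by (simp add: local_minimizer_on_def)
  obtain \<epsilon> where \<epsilon>: "\<epsilon> > 0" and local_min:
      "\<And>Z. positive_semidefinite Z \<Longrightarrow> rank Z \<le> s \<Longrightarrow> dist Z X < \<epsilon> \<Longrightarrow> f X \<le> f Z"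
    using min by (auto simp: local_minimizer_on_def)
  have rank_one: "0 \<le> f' X (outer u u)" for u
  proof (rule ccontr)
    assume "\<not> 0 \<le> f' X (outer u u)"
    then have neg: "f' X (outer u u) < 0" by simp
    have "((\<lambda>t. X + t *\<^sub>R outer u u) has_derivative (\<lambda>t. t *\<^sub>R outer u u)) (at 0)"
      by (auto intro!: derivative_eq_intros)
    moreover have "(f has_derivative f' X) (at (X + 0 *\<^sub>R outer u u))"
      using f' by simp
    ultimately have "((\<lambda>t. f (X + t *\<^sub>R outer u u)) has_derivative
        (\<lambda>t. f' X (t *\<^sub>R outer u u))) (at 0)"
      by (rule has_derivative_compose)
    then have "((\<lambda>t. f (X + t *\<^sub>R outer u u)) has_real_derivative f' X (outer u u)) (at 0)"
      by (simp add: has_field_derivative_def blinfun.scaleR_right mult_commute_abs)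
    from has_real_derivative_neg_dec_right[OF this neg]
    obtain d where d: "d > 0" "\<And>h. 0 < h \<Longrightarrow> h < d \<Longrightarrow> f (X + h *\<^sub>R outer u u) < f X"
      by auto
    \<comment> \<open>Small enough both for the strict decrease and for staying within
      \<open>\<epsilon>\<close> of \<open>X\<close>; the added 1 keeps the denominator
      positive.\<close>
    define h where "h = min (d / 2) (\<epsilon> / (2 * (norm (outer u u) + 1)))"
    have n: "norm (outer u u) + 1 > 0"
      using norm_ge_zero[of "outer u u"] by linarith
    have h: "0 < h" "h < d" "h \<le> \<epsilon> / (2 * (norm (outer u u) + 1))"
      using d(1) \<epsilon> n by (auto simp: h_def)
    have "h * (norm (outer u u) + 1) \<le> \<epsilon> / 2"
      using h(3) n by (simp add: field_simps)
    then have "h * norm (outer u u) < \<epsilon>"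
      using h(1) \<epsilon> by (simp add: distrib_left)
    then have "dist (X + h *\<^sub>R outer u u) X < \<epsilon>"
      using h(1) by (simp add: dist_norm)
    moreover have "positive_semidefinite (X + h *\<^sub>R outer u u)"
      using psd h(1)
      by (auto simp: positive_semidefinite_def matrix_mult_linear_simps transpose_outer
          matrix_vector_mult_add_rdistrib scaleR_matrix_vector_assoc[symmetric] outer_mult_vec
          inner_add_right inner_commute[of u] mult.assoc intro!: add_nonneg_nonneg)
    moreover have "rank (h *\<^sub>R outer u u) \<le> 1"
      using rank_outer_le[of "h *\<^sub>R u" u]
      by (simp add: outer_def scaleR_vec_def vec_eq_iff mult_ac)
    then have "rank (X + h *\<^sub>R outer u u) \<le> s"
      using rank_add_le[of X "h *\<^sub>R outer u u"] rank by linarith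
    ultimately have "f X \<le> f (X + h *\<^sub>R outer u u)"
      by (intro local_min)
    with d(2)[OF h(1,2)] show False by simp
  qed
  show ?thesis
    unfolding mult_transpose_eq_sum_outer blinfun.sum_right
    by (rule sum_nonneg) (rule rank_one)
qed

end

text \<open>The minimum of \<open>max (\<phi> (Y, \<theta>)) (dist (Y Y\<^sup>T) X)\<close> over a compact set is positive.\<close>

lemma uniform_positivity_near:
  fixes \<phi> :: "(real^'r^'p) \<times> (real^'r^'p) \<Rightarrow> real" and X :: "real^'p^'p"
  assumes "closed T" "continuous_on UNIV \<phi>"
    and pos: "\<And>Y \<theta>. (Y, \<theta>) \<in> T \<Longrightarrow> Y ** transpose Y = X \<Longrightarrow> norm \<theta> = 1 \<Longrightarrow> 0 < \<phi> (Y, \<theta>)"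
  obtains \<epsilon> where "\<epsilon> > 0"
    "\<And>Y \<theta>. (Y, \<theta>) \<in> T \<Longrightarrow> dist (Y ** transpose Y) X < \<epsilon> \<Longrightarrow> norm \<theta> = 1 \<Longrightarrow> \<epsilon> \<le> \<phi> (Y, \<theta>)"
proof -
  define K where "K = T \<inter> {p. dist (fst p ** transpose (fst p)) X \<le> 1} \<inter> {p. norm (snd p) = 1}"
  \<comment> \<open>The trace bound on \<open>Y\<close> when \<open>Y Y^T\<close> lies within
    distance 1 of \<open>X\<close>.\<close>
  define B where "B = sqrt (norm (mat 1 :: real^'p^'p) * (norm X + 1))"
  have "closed K"
    unfolding K_def using assms(1)
    by (intro closed_Int closed_Collect_le closed_Collect_eq continuous_intros)
  moreover have "K \<subseteq> cball 0 B \<times> cball 0 1"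
  proof
    fix p assume p: "p \<in> K"
    let ?Y = "fst p"
    have "norm (?Y ** transpose ?Y) \<le> norm X + 1"
      using p norm_triangle_sub[of "?Y ** transpose ?Y" X] by (simp add: K_def dist_norm)
    then have "norm (mat 1 :: real^'p^'p) * norm (?Y ** transpose ?Y)
        \<le> norm (mat 1 :: real^'p^'p) * (norm X + 1)"
      by (intro mult_left_mono) auto
    then have "(norm ?Y)\<^sup>2 \<le> norm (mat 1 :: real^'p^'p) * (norm X + 1)"
      using norm_le_norm_matrix_mult_transpose[of ?Y] by linarith
    then have "norm ?Y \<le> B"
      unfolding B_def by (rule real_le_rsqrt)
    then show "p \<in> cball 0 B \<times> cball 0 1"
      using p by (cases p) (simp add: K_def)
  qed
  then have "bounded K"
    by (rule bounded_subset[rotated]) (intro bounded_Times bounded_cball)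
  ultimately have K: "compact K" by (simp add: compact_eq_bounded_closed)
  define \<psi> where "\<psi> p = max (\<phi> p) (dist (fst p ** transpose (fst p)) X)" for p
  show ?thesis
  proof (cases "K = {}")
    case True
    show ?thesis
    proof (rule that[of 1])
      fix Y \<theta> assume "(Y, \<theta>) \<in> T" "dist (Y ** transpose Y) X < 1" "norm \<theta> = 1"
      then have "(Y, \<theta>) \<in> K" by (simp add: K_def)
      with True show "1 \<le> \<phi> (Y, \<theta>)" by simp
    qed simp
  next
    case False
    have "continuous_on K \<psi>"
      unfolding \<psi>_def by (intro continuous_intros continuous_on_subset[OF assms(2)]) auto
    then obtain p where p: "p \<in> K" and min: "\<And>q. q \<in> K \<Longrightarrow> \<psi> p \<le> \<psi> q"
      using continuous_attains_inf[OF K False] by blast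
    have "0 < \<psi> p"
    proof (cases "fst p ** transpose (fst p) = X")
      case True
      then have "0 < \<phi> p" using p pos[of "fst p" "snd p"] by (simp add: K_def)
      then show ?thesis by (simp add: \<psi>_def less_max_iff_disj)
    next
      case False
      then show ?thesis by (simp add: \<psi>_def less_max_iff_disj)
    qed
    show ?thesis
    \<comment> \<open>The cap at 1 puts the pair into \<open>K\<close>. A distance below
      \<open>\<psi> p\<close> cannot account for the maximum, so \<open>\<phi>\<close> must reach
      \<open>\<psi> p\<close>.\<close>
    proof (rule that[of "min (\<psi> p) 1"])
      fix Y \<theta> assume Y: "(Y, \<theta>) \<in> T" "dist (Y ** transpose Y) X < min (\<psi> p) 1" "norm \<theta> = 1"
      then have "(Y, \<theta>) \<in> K" by (simp add: K_def)
      from min[OF this] have "\<psi> p \<le> \<phi> (Y, \<theta>)"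
        using Y(2) by (simp add: \<psi>_def max_def split: if_splits)
      then show "min (\<psi> p) 1 \<le> \<phi> (Y, \<theta>)" by simp
    qed (use \<open>0 < \<psi> p\<close> in simp)
  qed
qed

section \<open>The neighborhood in the quotient and the final argument\<close>

text \<open>The distance condition depends on \<open>Y\<close> only through \<open>Y Y^T\<close>,
  which is constant on orbits; the preimage is thus the same condition on matrices, which is open by
  continuity.\<close>

lemma openin_quotient_sublevel:
  fixes X :: "real^'p^'p" and \<epsilon> :: real
  shows "openin quotient_topology
    (orbit ` {Y :: real^'r^'p. Y \<in> full_column_rank \<and> dist (Y ** transpose Y) X < \<epsilon>})"
    (is "openin _ ?U")
proof -
  have "{Y \<in> full_column_rank. orbit Y \<in> ?U}
      = full_column_rank \<inter> {Y. dist (Y ** transpose Y) X < \<epsilon>}" (is "?L = ?R")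
  proof
    show "?L \<subseteq> ?R"
    proof
      fix Y assume "Y \<in> ?L"
      then obtain Z where "Y \<in> full_column_rank" "orbit Y = orbit Z"
          "dist (Z ** transpose Z) X < \<epsilon>"
        by blast
      moreover from this have "Y ** transpose Y = Z ** transpose Z"
        using orbit_self[of Y] by (simp add: mult_transpose_eq_if_in_orbit)
      ultimately show "Y \<in> ?R" by simp
    qed
  qed auto
  moreover have "open {Y :: real^'r^'p. dist (Y ** transpose Y) X < \<epsilon>}"
    by (intro open_Collect_less continuous_intros)
  ultimately show ?thesis
    unfolding openin_quotient_topology by (auto simp: openin_open_Int)
qed

theorem theorem7:
  fixes f :: "real^'p^'p \<Rightarrow> real"
    and Yhat :: "real^'r^'p"
  assumes "CARD('r) \<le> CARD('p)"
    and "twice_continuously_differentiable f"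
    and "\<And>X. f X = f (transpose X)"
    and "restricted_strictly_convex (CARD('r)) (2 * CARD('r)) f"
    and "rank (Yhat ** transpose Yhat) = CARD('r)"
    and "local_minimizer_on f {X. positive_semidefinite X \<and> rank X \<le> 2 * CARD('r)}
           (Yhat ** transpose Yhat)"
  shows "\<exists>U. openin quotient_topology U \<and> orbit Yhat \<in> U \<and>
           geodesically_convex_on U (quotient_fun f)"
proof -
  define X where "X = Yhat ** transpose Yhat"
  obtain f' f'' where f': "\<And>X. (f has_derivative blinfun_apply (f' X)) (at X)"
    and f'': "\<And>X. (f' has_derivative blinfun_apply (f'' X)) (at X)"
    and cont_f'': "continuous_on UNIV f''"
    using assms(2) unfolding twice_continuously_differentiable_def by blast
  have cont_f': "continuous_on UNIV f'"
    using has_derivative_continuous[OF f''] by (auto simp: continuous_on_eq_continuous_at)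
  \<comment> \<open>Needed for every factor of \<open>X\<close>, not only \<open>Yhat\<close>, since
    the compactness lemma tests positivity at all of them.\<close>
  have full: "Y \<in> full_column_rank" if "Y ** transpose Y = X" for Y :: "real^'r^'p"
    using assms(5) that by (intro full_column_rank_if_rank_mult_transpose) (simp add: X_def)

  let ?S = "\<lambda>Y \<theta> :: real^'r^'p. Y ** transpose \<theta> + \<theta> ** transpose Y"
  define \<phi> where "\<phi> = (\<lambda>(Y :: real^'r^'p, \<theta> :: real^'r^'p).
    f'' (Y ** transpose Y) (?S Y \<theta>) (?S Y \<theta>) + 2 * f' (Y ** transpose Y) (\<theta> ** transpose \<theta>))"
  have closed_hor: "closed {(Y :: real^'r^'p, \<theta>). \<theta> \<in> horizontal Y}"
    unfolding horizontal_iff case_prod_unfold by (intro closed_Collect_eq continuous_intros)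
  have cont_\<phi>: "continuous_on UNIV \<phi>"
    unfolding \<phi>_def case_prod_unfold
    by (intro continuous_intros blinfun.continuous_on
        continuous_on_compose2[OF cont_f''] continuous_on_compose2[OF cont_f']) auto
  have pos_\<phi>: "0 < \<phi> (Y, \<theta>)"
    if "(Y, \<theta>) \<in> {(Y, \<theta>). \<theta> \<in> horizontal Y}" and Y: "Y ** transpose Y = X" and "norm \<theta> = 1"
    for Y \<theta> :: "real^'r^'p"
  proof -
    have hor: "\<theta> \<in> horizontal Y" and "\<theta> \<noteq> 0" using that by auto
    then have "Y ** transpose \<theta> \<noteq> 0" using mult_transpose_eq_0D[OF full[OF Y]] by blast
    then have "?S Y \<theta> \<noteq> 0" using norm_symmetrized_horizontal_ge[OF hor] by auto
    moreover have "rank (?S Y \<theta>) \<le> 2 * CARD('r)"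
      using rank_add_le[of "Y ** transpose \<theta>" "\<theta> ** transpose Y"]
        rank_mul_le_left[of Y "transpose \<theta>"] rank_mul_le_left[of \<theta> "transpose Y"]
        rank_bound[of Y] rank_bound[of \<theta>] by linarith
    moreover have "rank X \<le> CARD('r)" using assms(5) by (simp add: X_def)
    ultimately have "0 < f'' X (?S Y \<theta>) (?S Y \<theta>)"
      using assms(4) by (simp add: restricted_strictly_convex_def euclidean_hessian_eq[OF f' f''])
    \<comment> \<open>The strict rank inequality is \<open>r < 2 * r\<close>, valid because the
      index type \<open>'r\<close> is nonempty.\<close>
    moreover have "0 \<le> f' X (\<theta> ** transpose \<theta>)"
      by (rule first_order_nonneg[OF f' f'' assms(6)[folded X_def]])
        (simp add: X_def assms(5))
    ultimately show ?thesis by (simp add: \<phi>_def Y)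
  qed
  obtain \<epsilon>1 where \<epsilon>1: "\<epsilon>1 > 0" and hess:
    "\<And>Y \<theta>. (Y, \<theta>) \<in> {(Y, \<theta>). \<theta> \<in> horizontal Y} \<Longrightarrow> dist (Y ** transpose Y) X < \<epsilon>1 \<Longrightarrow>
       norm \<theta> = 1 \<Longrightarrow> \<epsilon>1 \<le> \<phi> (Y, \<theta>)"
    using uniform_positivity_near[OF closed_hor cont_\<phi> pos_\<phi>] by blast

  \<comment> \<open>A second use of the compactness lemma, without the horizontality constraint,
    provides the constant \<open>c\<close> for the geodesic convexity of the sublevel set.\<close>
  have cont_norm: "continuous_on UNIV (\<lambda>p :: (real^'r^'p) \<times> (real^'r^'p). (norm (fst p ** transpose (snd p)))\<^sup>2)"
    by (intro continuous_intros)
  have pos_norm: "0 < (norm (fst (Y, \<theta>) ** transpose (snd (Y, \<theta>))))\<^sup>2"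
    if "(Y, \<theta>) \<in> UNIV" "Y ** transpose Y = X" "norm \<theta> = 1" for Y \<theta> :: "real^'r^'p"
  proof -
    have "\<theta> \<noteq> 0" using that(3) by auto
    then have "Y ** transpose \<theta> \<noteq> 0" using mult_transpose_eq_0D[OF full[OF that(2)]] by blast
    then show ?thesis by simp
  qed
  obtain c where c: "c > 0" and lower:
    "\<And>Y \<theta> :: real^'r^'p. (Y, \<theta>) \<in> UNIV \<Longrightarrow> dist (Y ** transpose Y) X < c \<Longrightarrow> norm \<theta> = 1 \<Longrightarrow>
       c \<le> (norm (fst (Y, \<theta>) ** transpose (snd (Y, \<theta>))))\<^sup>2"
    using uniform_positivity_near[OF closed_UNIV cont_norm pos_norm] by blast

  \<comment> \<open>The bound by \<open>\<epsilon>1\<close> serves the Hessian; the bound by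
    \<open>c / 4\<close> serves geodesic convexity and also gives \<open>\<epsilon> \<le> c\<close>,
    where the lower bound is available.\<close>
  define \<epsilon> where "\<epsilon> = min \<epsilon>1 (c / 4)"
  have \<epsilon>: "\<epsilon> > 0" "\<epsilon> \<le> \<epsilon>1" "\<epsilon> \<le> c / 4" "\<epsilon> \<le> c"
    using \<epsilon>1 c by (auto simp: \<epsilon>_def)
  define U where "U = orbit ` {Y :: real^'r^'p. Y \<in> full_column_rank \<and> dist (Y ** transpose Y) X < \<epsilon>}"
  have "c * (norm \<theta>)\<^sup>2 \<le> (norm (Y ** transpose \<theta>))\<^sup>2"
    if "dist (Y ** transpose Y) X < \<epsilon>" for Y \<theta> :: "real^'r^'p"
  proof (cases "\<theta> = 0")
    case False
    have "c \<le> (norm (Y ** transpose ((1 / norm \<theta>) *\<^sub>R \<theta>)))\<^sup>2"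
      using lower[of Y "(1 / norm \<theta>) *\<^sub>R \<theta>"] False that \<epsilon>(4) by simp
    also have "\<dots> = (norm (Y ** transpose \<theta>))\<^sup>2 / (norm \<theta>)\<^sup>2"
      by (simp add: matrix_mult_linear_simps power_divide)
    finally show ?thesis using False by (simp add: field_simps)
  qed simp
  then have "geodesically_convex U"
    unfolding U_def by (rule geodesically_convex_sublevel[OF \<epsilon>(3)])
  moreover have "0 \<le> riemannian_hessian (quotient_fun f) Y \<theta> \<theta>"
    if "orbit Y \<in> U" and hor: "\<theta> \<in> horizontal Y" for Y \<theta> :: "real^'r^'p"
  proof -
    obtain Z where "orbit Y = orbit Z" "dist (Z ** transpose Z) X < \<epsilon>"
      using \<open>orbit Y \<in> U\<close> unfolding U_def by blast
    then have dY: "dist (Y ** transpose Y) X < \<epsilon>1"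
      using mult_transpose_eq_if_in_orbit[of Y Z] orbit_self[of Y] \<epsilon>(2) by simp
    have "0 \<le> \<phi> (Y, \<theta>)"
    proof (cases "\<theta> = 0")
      case False
      define u where "u = (1 / norm \<theta>) *\<^sub>R \<theta>"
      have "u \<in> horizontal Y"
        unfolding u_def using hor by (rule subspace_scale[OF subspace_horizontal])
      then have "\<epsilon>1 \<le> \<phi> (Y, u)"
        by (intro hess dY) (simp_all add: u_def False)
      \<comment> \<open>Quadratic homogeneity carries positivity from unit vectors to all horizontal
        vectors.\<close>
      moreover have "\<phi> (Y, a *\<^sub>R \<theta>) = a\<^sup>2 * \<phi> (Y, \<theta>)" for a
      proof -
        have S: "?S Y (a *\<^sub>R \<theta>) = a *\<^sub>R ?S Y \<theta>"
          by (simp only: matrix_mult_linear_simps scaleR_add_right)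
        show ?thesis
          unfolding \<phi>_def prod.case S
          by (simp add: matrix_mult_linear_simps blinfun.scaleR_left blinfun.scaleR_right
              power2_eq_square distrib_left)
      qed
      ultimately have "0 < (1 / norm \<theta>)\<^sup>2 * \<phi> (Y, \<theta>)"
        using \<epsilon>1 by (simp add: u_def)
      then show ?thesis
        using zero_le_power2[of "1 / norm \<theta>"] unfolding zero_less_mult_iff by linarith
    qed (simp add: \<phi>_def matrix_mult_linear_simps)
    then show ?thesis
      unfolding riemannian_hessian_quotient_fun[OF f' f'' hor] \<phi>_def prod.case .
  qed
  ultimately have "geodesically_convex_on U (quotient_fun f)"
    by (simp add: geodesically_convex_on_def)
  moreover have "openin quotient_topology U"
    unfolding U_def by (rule openin_quotient_sublevel)
  moreover have "orbit Yhat \<in> U"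
    unfolding U_def using \<epsilon>(1) full[of Yhat] by (auto simp: X_def)
  ultimately show ?thesis by blast
qed

end
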